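(* Admissible sign patterns are closed under minors and duality: if $s$ is an admissible sign pattern on a finite set $N$, then the dual $s^*$ is an admissible sign pattern on $N$, and every minor of $s$ is an admissible sign pattern on its ground set.
   Context: A sign pattern on a finite set $N$ is a function $s: 2^N \to \{+,-\}$; signs are multiplied as elements of $\{\pm1\}$. It is admissible if $s(\emptyset) = +$ and, for all $i \neq j$ in $N$ and all $K \subseteq N \setminus \{i,j\}$, the implication $[s(K\cup\{i\}) \neq s(K \cup\{j\})] \implies [s(K) \neq s(K\cup\{i,j\})]$ holds. The dual of $s$ is $s^*(K) = s(N)\cdot s(N\setminus K)$. For $K \subseteq N$, the deletion $s\setminus K$ is the restriction of $s$ to the subsets of $N \setminus K$. The contraction $s/K$ is the sign pattern on $N \setminus K$ with $(s/K)(\emptyset)=+$ determined by $(s/K)^{c}(L) = s^{c}(K \cup L)$ for $L \subseteq N\setminus K$, where for a sign pattern $t$ on a ground set $M$ the co-value is $t^{c}(L) = t(M)\cdot t(L)$. A minor of $s$ is any sign pattern arising from $s$ by a sequence of deletions and contractions. *)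

theory Defs
  imports Main "HOL-Library.FuncSet"
begin

text \<open>
  Signs are the integers \<open>1\<close> and \<open>-1\<close>, so that they multiply as usual. A sign pattern on \<open>N\<close> is
  an extensional function on \<open>Pow N\<close>: it is \<open>undefined\<close> outside \<open>Pow N\<close>, so that equality of
  sign patterns on \<open>N\<close> is equality of functions. The ground set cannot be recovered from the
  function and is passed along explicitly.
\<close>

definition sign_pattern :: "'a set \<Rightarrow> ('a set \<Rightarrow> int) \<Rightarrow> bool" where
  "sign_pattern N s \<longleftrightarrow> finite N \<and> s \<in> Pow N \<rightarrow>\<^sub>E {1, -1}"

definition admissible :: "'a set \<Rightarrow> ('a set \<Rightarrow> int) \<Rightarrow> bool" where
  "admissible N s \<longleftrightarrow>
     sign_pattern N s \<and> s {} = 1 \<and>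
     (\<forall>i\<in>N. \<forall>j\<in>N. i \<noteq> j \<longrightarrow>
       (\<forall>K. K \<subseteq> N - {i, j} \<longrightarrow>
         s (K \<union> {i}) \<noteq> s (K \<union> {j}) \<longrightarrow> s K \<noteq> s (K \<union> {i, j})))"

definition dual :: "'a set \<Rightarrow> ('a set \<Rightarrow> int) \<Rightarrow> ('a set \<Rightarrow> int)" where
  "dual N s = (\<lambda>K\<in>Pow N. s N * s (N - K))"

definition deletion :: "'a set \<Rightarrow> ('a set \<Rightarrow> int) \<Rightarrow> 'a set \<Rightarrow> ('a set \<Rightarrow> int)" where
  "deletion N s K = restrict s (Pow (N - K))"

definition covalue :: "'a set \<Rightarrow> ('a set \<Rightarrow> int) \<Rightarrow> ('a set \<Rightarrow> int)" where
  "covalue M t = (\<lambda>L\<in>Pow M. t M * t L)"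

text \<open>
  The description below determines the contraction uniquely whenever \<open>s\<close> is a sign pattern on \<open>N\<close>
  and \<open>K \<subseteq> N\<close>; see \<open>contraction_ex1\<close>.
\<close>

definition contraction :: "'a set \<Rightarrow> ('a set \<Rightarrow> int) \<Rightarrow> 'a set \<Rightarrow> ('a set \<Rightarrow> int)" where
  "contraction N s K =
     (THE t. sign_pattern (N - K) t \<and> t {} = 1 \<and>
       (\<forall>L. L \<subseteq> N - K \<longrightarrow> covalue (N - K) t L = covalue N s (K \<union> L)))"

lemma sign_pattern_sign:
  assumes "sign_pattern N s" "K \<subseteq> N"
  shows "s K = 1 \<or> s K = -1"
  using assms unfolding sign_pattern_def by (auto dest: PiE_mem)

lemma contraction_ex1:
  assumes s: "sign_pattern N s" and K: "K \<subseteq> N"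
  shows "\<exists>!t. sign_pattern (N - K) t \<and> t {} = 1 \<and>
           (\<forall>L. L \<subseteq> N - K \<longrightarrow> covalue (N - K) t L = covalue N s (K \<union> L))"
proof (rule ex1I)
  let ?t = "\<lambda>L\<in>Pow (N - K). s K * s (K \<union> L)"
  note sgn = sign_pattern_sign[OF s]
  have KN: "K \<union> (N - K) = N" using K by blast
  have "?t \<in> Pow (N - K) \<rightarrow>\<^sub>E {1, -1}"
  proof (rule restrict_PiE_iff[THEN iffD2], rule ballI)
    fix L assume "L \<in> Pow (N - K)"
    then have "K \<union> L \<subseteq> N" using K by blast
    then show "s K * s (K \<union> L) \<in> {1, -1}" using sgn[OF K] sgn[of "K \<union> L"] by auto
  qed
  moreover have "covalue (N - K) ?t L = covalue N s (K \<union> L)" if L: "L \<subseteq> N - K" for L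
  proof -
    have "K \<union> L \<subseteq> N" using L K by blast
    then show ?thesis using L K sgn[OF K] KN by (auto simp: covalue_def)
  qed
  ultimately show "sign_pattern (N - K) ?t \<and> ?t {} = 1 \<and>
      (\<forall>L. L \<subseteq> N - K \<longrightarrow> covalue (N - K) ?t L = covalue N s (K \<union> L))"
    using s sgn[OF K] by (auto simp: sign_pattern_def)
next
  fix t
  let ?t = "\<lambda>L\<in>Pow (N - K). s K * s (K \<union> L)"
  assume t: "sign_pattern (N - K) t \<and> t {} = 1 \<and>
      (\<forall>L. L \<subseteq> N - K \<longrightarrow> covalue (N - K) t L = covalue N s (K \<union> L))"
  have eq: "t (N - K) * t L = s N * s (K \<union> L)" if L: "L \<subseteq> N - K" for L
  proof -
    have "covalue (N - K) t L = covalue N s (K \<union> L)" "K \<union> L \<subseteq> N" using t L K by blast+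
    then show ?thesis using L by (simp add: covalue_def)
  qed
  have top: "t (N - K) = s N * s K" using eq[of "{}"] t by simp
  have "t L = s K * s (K \<union> L)" if L: "L \<subseteq> N - K" for L
    using eq[OF L] top sign_pattern_sign[OF s K] sign_pattern_sign[OF s order_refl] by auto
  moreover have "t \<in> extensional (Pow (N - K))"
    using t by (auto simp: sign_pattern_def PiE_iff)
  ultimately show "t = ?t"
    by (intro extensionalityI[of _ "Pow (N - K)"]) auto
qed

text \<open>
  \<open>is_minor N s M t\<close>: the function \<open>t\<close>, with ground set \<open>M\<close>, arises from \<open>s\<close>, with ground set \<open>N\<close>,
  by a finite (possibly empty) sequence of deletions and contractions.
\<close>

inductive is_minor :: "'a set \<Rightarrow> ('a set \<Rightarrow> int) \<Rightarrow> 'a set \<Rightarrow> ('a set \<Rightarrow> int) \<Rightarrow> bool"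
  for N :: "'a set" and s :: "'a set \<Rightarrow> int" where
  refl: "is_minor N s N s"
| deletion: "\<lbrakk>is_minor N s M t; K \<subseteq> M\<rbrakk> \<Longrightarrow> is_minor N s (M - K) (deletion M t K)"
| contraction: "\<lbrakk>is_minor N s M t; K \<subseteq> M\<rbrakk> \<Longrightarrow> is_minor N s (M - K) (contraction M t K)"

end

theory Submission
  imports Defs
begin

text \<open>
  Complementation turns the condition for \<open>i, j, K\<close> into the one for \<open>i, j, N - K - {i, j}\<close> with the
  two sides of each inequality exchanged, and the factor \<open>s N\<close> cancels; this settles the dual.
  Unfolding co-values, the contraction is \<open>L \<mapsto> s K * s (K \<union> L)\<close>, so up to a constant sign
  its condition for \<open>L\<close> is that of \<open>s\<close> for \<open>K \<union> L\<close>.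
\<close>

text \<open>Replaces the definite description by a formula. It is well defined by
  \<open>contraction_ex1\<close>, and the co-value equations, once the value on the top set
  \<open>N - K\<close> is known, fix every other value because signs square to 1.\<close>

lemma contraction_eq:
  assumes s: "sign_pattern N s" and K: "K \<subseteq> N"
  shows "contraction N s K = (\<lambda>L\<in>Pow (N - K). s K * s (K \<union> L))"
proof -
  let ?c = "contraction N s K"
  have c: "sign_pattern (N - K) ?c \<and> ?c {} = 1 \<and>
      (\<forall>L. L \<subseteq> N - K \<longrightarrow> covalue (N - K) ?c L = covalue N s (K \<union> L))"
    unfolding contraction_def by (rule theI'[OF contraction_ex1[OF s K]])
  have eq: "?c (N - K) * ?c L = s N * s (K \<union> L)" if "L \<subseteq> N - K" for L
  proof -
    have "covalue (N - K) ?c L = covalue N s (K \<union> L)" "K \<union> L \<subseteq> N"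
      using c that K by blast+
    then show ?thesis using that by (simp add: covalue_def)
  qed
  \<comment> \<open>At \<open>L = {}\<close> the normalization \<open>?c {} = 1\<close> isolates the
    top value; multiplying the general equation by it then cancels \<open>s N\<close>.\<close>
  have top: "?c (N - K) = s N * s K" using eq[of "{}"] c by simp
  have "?c L = s K * s (K \<union> L)" if "L \<subseteq> N - K" for L
    using eq[OF that] top sign_pattern_sign[OF s K] sign_pattern_sign[OF s order_refl] by auto
  moreover have "?c \<in> extensional (Pow (N - K))"
    using c by (auto simp: sign_pattern_def PiE_iff)
  ultimately show ?thesis
    by (intro extensionalityI[of _ "Pow (N - K)"]) auto
qed

lemma admissibleD:
  assumes "admissible N s" "i \<in> N" "j \<in> N" "i \<noteq> j" "K \<subseteq> N - {i, j}"
    and "s (K \<union> {i}) \<noteq> s (K \<union> {j})"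
  shows "s K \<noteq> s (K \<union> {i, j})"
  using assms unfolding admissible_def by blast

text \<open>Dual, deletion and contraction are all restrictions of a total function to a power set.
  All four sets in the condition lie in that power set, so it may be checked on the unrestricted
  function.\<close>

lemma admissible_restrictI:
  assumes "finite N" and "\<And>K. K \<subseteq> N \<Longrightarrow> f K \<in> {1, -1}" and "f {} = 1"
    and "\<And>i j K. \<lbrakk>i \<in> N; j \<in> N; i \<noteq> j; K \<subseteq> N - {i, j}; f (K \<union> {i}) \<noteq> f (K \<union> {j})\<rbrakk>
      \<Longrightarrow> f K \<noteq> f (K \<union> {i, j})"
  shows "admissible N (restrict f (Pow N))"
  unfolding admissible_def
proof (intro conjI ballI allI impI)
  show "sign_pattern N (restrict f (Pow N))"
    using assms(1,2) by (auto simp: sign_pattern_def)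
  show "restrict f (Pow N) {} = 1"
    using assms(3) by simp
next
  fix i j K
  assume ij: "i \<in> N" "j \<in> N" "i \<noteq> j" and K: "K \<subseteq> N - {i, j}"
    and ne: "restrict f (Pow N) (K \<union> {i}) \<noteq> restrict f (Pow N) (K \<union> {j})"
  have sub: "K \<subseteq> N" "K \<union> {i} \<subseteq> N" "K \<union> {j} \<subseteq> N" "K \<union> {i, j} \<subseteq> N"
    using ij K by auto
  have "f (K \<union> {i}) \<noteq> f (K \<union> {j})"
    using ne sub by (simp only: restrict_apply' PowI not_False_eq_True)
  from assms(4)[OF ij K this] show "restrict f (Pow N) K \<noteq> restrict f (Pow N) (K \<union> {i, j})"
    using sub by (simp only: restrict_apply' PowI not_False_eq_True)
qed

lemma admissible_dual:
  assumes s: "admissible N s"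
  shows "admissible N (dual N s)"
  unfolding dual_def
proof (rule admissible_restrictI)
  have sp: "sign_pattern N s" using s by (simp add: admissible_def)
  note sgn = sign_pattern_sign[OF sp]
  show "finite N" using sp by (simp add: sign_pattern_def)
  show "s N * s (N - K) \<in> {1, -1}" for K
    using sgn[OF order_refl] sgn[of "N - K"] by auto
  show "s N * s (N - {}) = 1"
    using sgn[OF order_refl] by auto
  fix i j K
  assume ij: "i \<in> N" "j \<in> N" "i \<noteq> j" and K: "K \<subseteq> N - {i, j}"
    and ne: "s N * s (N - (K \<union> {i})) \<noteq> s N * s (N - (K \<union> {j}))"
  define K' where "K' = N - K - {i, j}"
  \<comment> \<open>Complementing swaps \<open>i\<close> with \<open>j\<close>, and the smallest of
    the four sets with the largest.\<close>
  have compl: "N - (K \<union> {i}) = K' \<union> {j}" "N - (K \<union> {j}) = K' \<union> {i}"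
    "N - K = K' \<union> {i, j}" "N - (K \<union> {i, j}) = K'"
    using ij K unfolding K'_def by auto
  have "s (K' \<union> {i}) \<noteq> s (K' \<union> {j})"
    using ne unfolding compl by auto
  moreover have "K' \<subseteq> N - {i, j}" unfolding K'_def by blast
  ultimately have "s K' \<noteq> s (K' \<union> {i, j})"
    using admissibleD[OF s ij] by blast
  \<comment> \<open>Multiplying by \<open>s N\<close> preserves the inequality because a sign is
    nonzero.\<close>
  then show "s N * s (N - K) \<noteq> s N * s (N - (K \<union> {i, j}))"
    unfolding compl using sgn[OF order_refl] by auto
qed

text \<open>Each instance of the condition over \<open>N - K\<close> is already an instance over
  \<open>N\<close>.\<close>

lemma admissible_deletion:
  assumes s: "admissible N s"
  shows "admissible (N - K) (deletion N s K)"
  unfolding deletion_def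
proof (rule admissible_restrictI)
  have sp: "sign_pattern N s" using s by (simp add: admissible_def)
  show "finite (N - K)" using sp by (simp add: sign_pattern_def)
  show "s L \<in> {1, -1}" if "L \<subseteq> N - K" for L
    using sign_pattern_sign[OF sp, of L] that by blast
  show "s {} = 1" using s by (simp add: admissible_def)
  show "s L \<noteq> s (L \<union> {i, j})"
    if "i \<in> N - K" "j \<in> N - K" "i \<noteq> j" "L \<subseteq> N - K - {i, j}" "s (L \<union> {i}) \<noteq> s (L \<union> {j})"
    for i j L
    using admissibleD[OF s, of i j L] that by blast
qed

lemma admissible_contraction:
  assumes s: "admissible N s" and K: "K \<subseteq> N"
  shows "admissible (N - K) (contraction N s K)"
proof -
  have sp: "sign_pattern N s" using s by (simp add: admissible_def)
  note sgn = sign_pattern_sign[OF sp]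
  show ?thesis
    unfolding contraction_eq[OF sp K]
  proof (rule admissible_restrictI)
    show "finite (N - K)" using sp by (simp add: sign_pattern_def)
    show "s K * s (K \<union> L) \<in> {1, -1}" if "L \<subseteq> N - K" for L
    proof -
      have "K \<union> L \<subseteq> N" using K that by blast
      then show ?thesis using sgn[OF K] sgn[of "K \<union> L"] by auto
    qed
    \<comment> \<open>The factor \<open>s K\<close> normalizes the contraction: its square is
      1.\<close>
    show "s K * s (K \<union> {}) = 1" using sgn[OF K] by auto
    fix i j L
    assume ij: "i \<in> N - K" "j \<in> N - K" "i \<noteq> j" and L: "L \<subseteq> N - K - {i, j}"
      and ne: "s K * s (K \<union> (L \<union> {i})) \<noteq> s K * s (K \<union> (L \<union> {j}))"
    have "s ((K \<union> L) \<union> {i}) \<noteq> s ((K \<union> L) \<union> {j})"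
      using ne unfolding Un_assoc by auto
    \<comment> \<open>\<open>K\<close> avoids \<open>i\<close> and \<open>j\<close> since both are
      taken from \<open>N - K\<close>.\<close>
    moreover have "K \<union> L \<subseteq> N - {i, j}" using ij K L by blast
    ultimately have "s (K \<union> L) \<noteq> s ((K \<union> L) \<union> {i, j})"
      using admissibleD[OF s, of i j "K \<union> L"] ij by blast
    then show "s K * s (K \<union> L) \<noteq> s K * s (K \<union> (L \<union> {i, j}))"
      unfolding Un_assoc using sgn[OF K] by auto
  qed
qed

text \<open>Induction along the sequence of operations, the empty sequence being the assumption on
  \<open>s\<close>.\<close>

lemma admissible_minor:
  assumes "is_minor N s M t" and "admissible N s"
  shows "admissible M t"
  using assms by induction (auto intro: admissible_deletion admissible_contraction)

theorem lemma2p4: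
  fixes N :: "'a set" and s :: "'a set \<Rightarrow> int"
  assumes "admissible N s"
  shows "admissible N (dual N s) \<and> (\<forall>M t. is_minor N s M t \<longrightarrow> admissible M t)"
  using assms by (blast intro: admissible_dual admissible_minor)

end
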